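(* Let $(A,D(A))$ be a closed and densely defined operator on a complex Banach space $X$ which generates a $C_0$-semigroup $(T_{0}(t))_{t\ge0}$. Then $$s_n^{0}(A)=\omega_n^{0}(A)=\sup_{t>0}\frac1t\log\|T_{0}(t)\|=\lim_{t\searrow0}\frac1t\log\|T_{0}(t)\|,$$ as elements of $[-\infty,+\infty]$.
   Context: For $\theta\in[0,2\pi)$ and $\omega\in\mathbb{R}$ let $H_{\theta,\omega}:=\{e^{i\theta}\lambda:\ \lambda\in\mathbb{C},\ \mathrm{Re}\,\lambda>\omega\}$, an open half plane with boundary $\partial H_{\theta,\omega}$, and let $d(\lambda,\partial H_{\theta,\omega}):=\inf\{|\lambda-\mu|:\mu\in\partial H_{\theta,\omega}\}$. For a closed, densely defined operator $(A,D(A))$ with resolvent set $\rho(A)$ and resolvent $R(\lambda,A)=(\lambda-A)^{-1}$, the numerical resolvent set $\rho_n(A)$ is the union of all open half planes $H_{\theta,\omega}$ (with $\theta\in[0,2\pi)$, $\omega\in\mathbb{R}$) such that $H_{\theta,\omega}\subseteq\rho(A)$ and $\|R(\lambda,A)\|\le \frac{1}{d(\lambda,\partial H_{\theta,\omega})}$ for all $\lambda\in H_{\theta,\omega}$. The numerical spectrum is $\sigma_n(A):=\mathbb{C}\setminus\rho_n(A)$. The numerical spectral bound (for the angle $\theta=0$) is $s_n^{0}(A):=s_n(A):=\sup\{\mathrm{Re}\,\lambda:\lambda\in\sigma_n(A)\}$. The numerical growth bound for the angle $\theta=0$ is $\omega_n^{0}(A):=\inf\{\omega\in\mathbb{R}:\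 \|T_{0}(t)\|\le e^{t\omega}\text{ for all }t\ge0\}$, with $\inf\emptyset:=+\infty$. Convention: $\log 0:=-\infty$. *)

theory Defs
  imports "HOL-Analysis.Analysis"
begin

text \<open>
  The libraries provide only real Banach spaces (class \<^class>\<open>banach\<close>).  A complex Banach space is
  a real one together with a complex scalar multiplication that extends the real one and for which
  the norm is absolutely homogeneous.  Unitality follows from \<open>scaleR_scaleC\<close>.
\<close>

class complex_banach = banach +
  fixes scaleC :: "complex \<Rightarrow> 'a \<Rightarrow> 'a"  (infixr \<open>*\<^sub>C\<close> 75)
  assumes scaleC_add_right: "c *\<^sub>C (x + y) = c *\<^sub>C x + c *\<^sub>C y"
    and scaleC_add_left: "(c + d) *\<^sub>C x = c *\<^sub>C x + d *\<^sub>C x"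
    and scaleC_scaleC: "c *\<^sub>C (d *\<^sub>C x) = (c * d) *\<^sub>C x"
    and scaleR_scaleC: "r *\<^sub>R x = complex_of_real r *\<^sub>C x"
    and norm_scaleC: "norm (c *\<^sub>C x) = cmod c * norm x"

instantiation complex :: complex_banach
begin

definition scaleC_complex :: "complex \<Rightarrow> complex \<Rightarrow> complex"
  where "scaleC_complex c x = c * x"

instance
  by standard (simp_all add: scaleC_complex_def algebra_simps scaleR_conv_of_real norm_mult)

end

text \<open>
  An unbounded operator \<open>(A, D(A))\<close> is a pair of a domain \<open>D\<close> and a total function \<open>A\<close>; only the
  values of \<open>A\<close> on \<open>D\<close> matter.
\<close>

definition linear_operator :: "'a::complex_banach set \<Rightarrow> ('a \<Rightarrow> 'a) \<Rightarrow> bool" where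
  "linear_operator D A \<longleftrightarrow>
     0 \<in> D \<and> (\<forall>x\<in>D. \<forall>y\<in>D. x + y \<in> D) \<and> (\<forall>c. \<forall>x\<in>D. c *\<^sub>C x \<in> D) \<and>
     (\<forall>x\<in>D. \<forall>y\<in>D. A (x + y) = A x + A y) \<and> (\<forall>c. \<forall>x\<in>D. A (c *\<^sub>C x) = c *\<^sub>C A x)"

definition closed_operator :: "'a::complex_banach set \<Rightarrow> ('a \<Rightarrow> 'a) \<Rightarrow> bool" where
  "closed_operator D A \<longleftrightarrow> linear_operator D A \<and> closed ((\<lambda>x. (x, A x)) ` D)"

definition densely_defined :: "'a::complex_banach set \<Rightarrow> bool" where
  "densely_defined D \<longleftrightarrow> closure D = UNIV"

definition bounded_clinear :: "('a::complex_banach \<Rightarrow> 'a) \<Rightarrow> bool" where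
  "bounded_clinear f \<longleftrightarrow> bounded_linear f \<and> (\<forall>c x. f (c *\<^sub>C x) = c *\<^sub>C f x)"

definition C0_semigroup :: "(real \<Rightarrow> 'a::complex_banach \<Rightarrow> 'a) \<Rightarrow> bool" where
  "C0_semigroup T \<longleftrightarrow>
     (\<forall>t\<ge>0. bounded_clinear (T t)) \<and>
     T 0 = id \<and> (\<forall>s\<ge>0. \<forall>t\<ge>0. T (s + t) = T s \<circ> T t) \<and>
     (\<forall>x. continuous_on {0..} (\<lambda>t. T t x))"

definition generates ::
  "'a::complex_banach set \<Rightarrow> ('a \<Rightarrow> 'a) \<Rightarrow> (real \<Rightarrow> 'a \<Rightarrow> 'a) \<Rightarrow> bool" where
  "generates D A T \<longleftrightarrow>
     D = {x. \<exists>y. ((\<lambda>t. (1 / t) *\<^sub>R (T t x - x)) \<longlongrightarrow> y) (at_right 0)} \<and>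
     (\<forall>x\<in>D. ((\<lambda>t. (1 / t) *\<^sub>R (T t x - x)) \<longlongrightarrow> A x) (at_right 0))"

definition resolvent :: "'a::complex_banach set \<Rightarrow> ('a \<Rightarrow> 'a) \<Rightarrow> complex \<Rightarrow> 'a \<Rightarrow> 'a" where
  "resolvent D A z = the_inv_into D (\<lambda>x. z *\<^sub>C x - A x)"

definition resolvent_set :: "'a::complex_banach set \<Rightarrow> ('a \<Rightarrow> 'a) \<Rightarrow> complex set" where
  "resolvent_set D A =
     {z. bij_betw (\<lambda>x. z *\<^sub>C x - A x) D UNIV \<and> bounded_clinear (resolvent D A z)}"

definition half_plane :: "real \<Rightarrow> real \<Rightarrow> complex set" where
  "half_plane \<theta> \<omega> = {exp (\<i> * of_real \<theta>) * z |z. Re z > \<omega>}"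

definition numerical_resolvent_set :: "'a::complex_banach set \<Rightarrow> ('a \<Rightarrow> 'a) \<Rightarrow> complex set" where
  "numerical_resolvent_set D A =
     \<Union>{half_plane \<theta> \<omega> |\<theta> \<omega>. 0 \<le> \<theta> \<and> \<theta> < 2 * pi \<and> half_plane \<theta> \<omega> \<subseteq> resolvent_set D A \<and>
        (\<forall>z\<in>half_plane \<theta> \<omega>.
           onorm (resolvent D A z) \<le> 1 / infdist z (frontier (half_plane \<theta> \<omega>)))}"

definition numerical_spectrum :: "'a::complex_banach set \<Rightarrow> ('a \<Rightarrow> 'a) \<Rightarrow> complex set" where
  "numerical_spectrum D A = - numerical_resolvent_set D A"

definition numerical_spectral_bound :: "'a::complex_banach set \<Rightarrow> ('a \<Rightarrow> 'a) \<Rightarrow> ereal" where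
  "numerical_spectral_bound D A = (SUP z\<in>numerical_spectrum D A. ereal (Re z))"

definition numerical_growth_bound :: "(real \<Rightarrow> 'a::complex_banach \<Rightarrow> 'a) \<Rightarrow> ereal" where
  "numerical_growth_bound T =
     (INF \<omega>\<in>{\<omega>::real. \<forall>t\<ge>0. onorm (T t) \<le> exp (t * \<omega>)}. ereal \<omega>)"

text \<open>The library's real logarithm has \<open>ln 0 = 0\<close>; here \<open>log 0 = -\<infinity>\<close>.\<close>

definition elog :: "real \<Rightarrow> ereal" where
  "elog x = (if x = 0 then -\<infinity> else ereal (ln x))"

end

theory Submission
  imports Defs
begin

text \<open>
  A half plane of the numerical resolvent set says, in one direction, that the rotated and shifted
  operator is dissipative; the growth bound of the semigroup says the same for the direction
  \<open>\<theta> = 0\<close>. The equality of the two bounds is thus a comparison of numerical ranges, carried out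
  with the right derivative \<open>p\<^sub>x(y)\<close> of the norm at \<open>x\<close> in the direction
  \<open>y\<close>, which plays the role of the supremum of \<open>Re \<psi>(y)\<close> over the normalised duality
  functionals \<open>\<psi>\<close> of \<open>x\<close> and is available without the Hahn-Banach theorem.

  Growth bound below spectral bound: if \<open>H\<close> is an admissible half plane with angle
  \<open>\<theta>\<close> and abscissa \<open>\<omega>\<close>, then the contractions
  \<open>(1/h) e\<^sup>i\<^sup>\<theta> R(e\<^sup>i\<^sup>\<theta>(\<omega> + 1/h), A)\<close> agree on \<open>D\<close> with
  \<open>I + h(e\<^sup>-\<^sup>i\<^sup>\<theta> A - \<omega>)\<close> up to \<open>o(h)\<close>, so that
  \<open>p\<^sub>x(e\<^sup>-\<^sup>i\<^sup>\<theta> A x) \<le> \<omega> \<parallel>x\<parallel>\<close> (lemma \<open>norm_deriv_le_of_half_plane\<close>). The numerical resolvent set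
  is a union of half planes in all directions, and a point with large real part may be covered only
  by tilted ones. Still, \<open>c \<mapsto> p\<^sub>x(c A x)\<close> is sublinear on the plane, and lies above some
  \<open>c \<mapsto> \<parallel>x\<parallel> Re (c u)\<close> with equality at \<open>c = 1\<close>; the number \<open>u\<close> is outside every admissible half
  plane. Hence \<open>p\<^sub>x(A x) / \<parallel>x\<parallel>\<close> is the real part of a point of the numerical spectrum (lemma
  \<open>norm_deriv_eq_numerical_spectrum\<close>), and is at most \<open>w\<close> for every real \<open>w\<close> not below the numerical
  spectral bound. As \<open>p\<^sub>x(A x)\<close> is the right derivative of \<open>\<parallel>T(t)x\<parallel>\<close> at \<open>t = 0\<close>, and \<open>D\<close> is
  invariant and dense, \<open>\<parallel>T(t)\<parallel> \<le> e\<^sup>w\<^sup>t\<close> follows (lemma \<open>exponential_bound_of_norm_deriv\<close>).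

  Spectral bound below growth bound: if \<open>\<parallel>T(t)\<parallel> \<le> e\<^sup>\<omega>\<^sup>t\<close> and \<open>Re z > \<omega>\<close>, the rescaled semigroup
  \<open>e\<^sup>-\<^sup>z\<^sup>t T(t)\<close> decays exponentially, which makes its generator \<open>A - z\<close> invertible with the
  right bound (lemma \<open>resolvent_of_exponential_bound\<close>); so the half plane \<open>Re z > \<omega>\<close> is
  admissible.

  Growth bound, supremum and limit: \<open>\<parallel>T(t)\<parallel> \<le> e\<^sup>t\<^sup>\<omega>\<close> is the same as \<open>log \<parallel>T(t)\<parallel> / t \<le> \<omega>\<close>, which
  gives the supremum. For the limit, every value of the quotient is exceeded, up to an arbitrarily
  small amount, for all small \<open>t\<close>: the quotient does not increase from \<open>t\<close> to \<open>n t\<close>, the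
  multiples of a small \<open>t\<close> come close to any given \<open>s\<close>, and \<open>t \<mapsto> \<parallel>T(t)\<parallel>\<close> is lower
  semicontinuous by strong continuity (lemma \<open>onorm_greater_persists\<close>).
\<close>

section \<open>Complex scalar multiplication\<close>

lemma scaleC_one [simp]: "1 *\<^sub>C x = (x :: 'a::complex_banach)"
  using scaleR_scaleC[of 1 x] by simp

lemma bounded_linear_scaleC: "bounded_linear (\<lambda>x :: 'a::complex_banach. c *\<^sub>C x)"
proof (rule bounded_linear_intro[where K = "cmod c"])
  show "c *\<^sub>C (r *\<^sub>R x) = r *\<^sub>R c *\<^sub>C x" for r and x :: 'a
    by (simp add: scaleR_scaleC scaleC_scaleC mult.commute)
qed (simp_all add: scaleC_add_right norm_scaleC mult.commute)

lemma bounded_bilinear_scaleC: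
  "bounded_bilinear (scaleC :: complex \<Rightarrow> 'a::complex_banach \<Rightarrow> 'a)"
proof
  show "\<exists>K. \<forall>a (b :: 'a). norm (a *\<^sub>C b) \<le> norm a * norm b * K"
    by (rule exI[of _ 1]) (simp add: norm_scaleC)
  show "(r *\<^sub>R a) *\<^sub>C b = r *\<^sub>R a *\<^sub>C b" for r a and b :: 'a
    by (simp add: scaleR_scaleC[where 'a = 'a] scaleC_scaleC scaleR_conv_of_real)
  show "a *\<^sub>C r *\<^sub>R b = r *\<^sub>R a *\<^sub>C b" for r a and b :: 'a
    by (simp add: scaleR_scaleC[where 'a = 'a] scaleC_scaleC mult.commute)
qed (simp_all add: scaleC_add_left scaleC_add_right)

interpretation scaleC: bounded_bilinear "scaleC :: complex \<Rightarrow> 'a::complex_banach \<Rightarrow> 'a"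
  by (rule bounded_bilinear_scaleC)

section \<open>The right derivative of the norm\<close>

text \<open>
  By convexity of the norm the difference quotient is nondecreasing in \<open>h\<close>, so its infimum is
  its limit as \<open>h\<close> tends to \<open>0\<close> from the right. The infimum makes upper estimates immediate, since one
  value of \<open>h\<close> suffices.
\<close>

definition norm_deriv :: "'a::real_normed_vector \<Rightarrow> 'a \<Rightarrow> real" where
  "norm_deriv x y = (INF h\<in>{0<..}. (norm (x + h *\<^sub>R y) - norm x) / h)"

lemma bdd_below_norm_quotient:
  "bdd_below ((\<lambda>h. (norm (x + h *\<^sub>R y) - norm x) / h) ` {0<..})"
proof (rule bdd_belowI2[where m = "- norm y"])
  fix h :: real assume "h \<in> {0<..}"
  moreover have "norm x \<le> norm (x + h *\<^sub>R y) + \<bar>h\<bar> * norm y"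
    by (metis add_diff_cancel_right' norm_scaleR norm_triangle_ineq4)
  ultimately show "- norm y \<le> (norm (x + h *\<^sub>R y) - norm x) / h"
    by (simp add: field_simps)
qed

lemma norm_deriv_le_quotient:
  "h > 0 \<Longrightarrow> norm_deriv x y \<le> (norm (x + h *\<^sub>R y) - norm x) / h"
  unfolding norm_deriv_def by (rule cINF_lower[OF bdd_below_norm_quotient]) auto

lemma norm_quotient_mono:
  fixes x y :: "'a::real_normed_vector"
  assumes "0 < h" "h \<le> k"
  shows "(norm (x + h *\<^sub>R y) - norm x) / h \<le> (norm (x + k *\<^sub>R y) - norm x) / k"
proof -
  have "x + h *\<^sub>R y = (1 - h / k) *\<^sub>R x + (h / k) *\<^sub>R (x + k *\<^sub>R y)"
    using assms by (simp add: algebra_simps)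
  then have "norm (x + h *\<^sub>R y) \<le> \<bar>1 - h / k\<bar> * norm x + \<bar>h / k\<bar> * norm (x + k *\<^sub>R y)"
    by (metis norm_scaleR norm_triangle_ineq)
  also have "\<dots> = (1 - h / k) * norm x + (h / k) * norm (x + k *\<^sub>R y)"
    using assms by simp
  finally show ?thesis
    using assms by (simp add: field_simps)
qed

lemma norm_deriv_less_imp_quotient_less:
  assumes "norm_deriv x y < a"
  obtains k where "k > 0" "\<And>h. 0 < h \<Longrightarrow> h \<le> k \<Longrightarrow> (norm (x + h *\<^sub>R y) - norm x) / h < a"
proof -
  obtain k where "k > 0" "(norm (x + k *\<^sub>R y) - norm x) / k < a"
    using assms unfolding norm_deriv_def
    by (subst (asm) cINF_less_iff[OF _ bdd_below_norm_quotient]) auto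
  then show thesis
    using that norm_quotient_mono order_le_less_trans by blast
qed

text \<open>
  The midpoint of \<open>x + 2 h y\<close> and \<open>x + 2 h z\<close> is \<open>x + h (y + z)\<close>; monotonicity of the quotients
  permits the same small \<open>h\<close> for both directions.
\<close>

lemma norm_deriv_add_le: "norm_deriv x (y + z) \<le> norm_deriv x y + norm_deriv x z"
proof (rule field_le_epsilon)
  fix e :: real assume "e > 0"
  then have "norm_deriv x y < norm_deriv x y + e / 2" "norm_deriv x z < norm_deriv x z + e / 2"
    by auto
  then obtain k l where "k > 0" "l > 0"
    and k: "\<And>h. 0 < h \<Longrightarrow> h \<le> k \<Longrightarrow> (norm (x + h *\<^sub>R y) - norm x) / h < norm_deriv x y + e / 2"
    and l: "\<And>h. 0 < h \<Longrightarrow> h \<le> l \<Longrightarrow> (norm (x + h *\<^sub>R z) - norm x) / h < norm_deriv x z + e / 2"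
    by (metis norm_deriv_less_imp_quotient_less)
  define h where "h = min k l / 2"
  have h: "h > 0" "2 * h \<le> k" "2 * h \<le> l"
    using \<open>k > 0\<close> \<open>l > 0\<close> by (auto simp: h_def)
  have "x + h *\<^sub>R (y + z) = (1/2) *\<^sub>R (x + (2 * h) *\<^sub>R y) + (1/2) *\<^sub>R (x + (2 * h) *\<^sub>R z)"
    by (simp add: algebra_simps flip: scaleR_add_left)
  then have "norm (x + h *\<^sub>R (y + z))
      \<le> \<bar>1/2\<bar> * norm (x + (2 * h) *\<^sub>R y) + \<bar>1/2\<bar> * norm (x + (2 * h) *\<^sub>R z)"
    by (metis norm_scaleR norm_triangle_ineq)
  then have "(norm (x + h *\<^sub>R (y + z)) - norm x) / h
      \<le> ((norm (x + (2 * h) *\<^sub>R y) + norm (x + (2 * h) *\<^sub>R z)) / 2 - norm x) / h"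
    using h by (intro divide_right_mono) auto
  also have "\<dots> = (norm (x + (2 * h) *\<^sub>R y) - norm x) / (2 * h)
      + (norm (x + (2 * h) *\<^sub>R z) - norm x) / (2 * h)"
    by (simp add: diff_divide_distrib add_divide_distrib)
  finally have "(norm (x + h *\<^sub>R (y + z)) - norm x) / h
      \<le> (norm (x + (2 * h) *\<^sub>R y) - norm x) / (2 * h)
        + (norm (x + (2 * h) *\<^sub>R z) - norm x) / (2 * h)" .
  with k[of "2 * h"] l[of "2 * h"] h norm_deriv_le_quotient[of h x "y + z"]
  show "norm_deriv x (y + z) \<le> norm_deriv x y + norm_deriv x z + e"
    by simp
qed

lemma norm_deriv_scaleR:
  assumes "s > 0" shows "norm_deriv x (s *\<^sub>R y) = s * norm_deriv x y"
proof -
  have *: "s * norm_deriv x y \<le> norm_deriv x (s *\<^sub>R y)" if "s > 0" for s y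
  proof -
    have "s * norm_deriv x y \<le> (norm (x + h *\<^sub>R s *\<^sub>R y) - norm x) / h" if "h > 0" for h
      using norm_deriv_le_quotient[of "h * s" x y] that \<open>s > 0\<close> by (simp add: field_simps)
    then show ?thesis
      unfolding norm_deriv_def[of x "s *\<^sub>R y"] by (intro cINF_greatest) auto
  qed
  have "norm_deriv x (s *\<^sub>R y) \<le> s * norm_deriv x y"
    using *[of "inverse s" "s *\<^sub>R y"] assms by (simp add: field_simps)
  with *[of s y] assms show ?thesis by simp
qed

text \<open>
  For small \<open>h\<close> the factor \<open>1 + h r\<close> is nonnegative, also for negative \<open>r\<close>, so the norm of
  \<open>x + h r x\<close> is exactly \<open>(1 + h r)\<close> times that of \<open>x\<close>.
\<close>

lemma norm_deriv_same_le: "norm_deriv x (r *\<^sub>R x) \<le> r * norm x"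
proof -
  \<comment> \<open>Small enough for \<open>1 + h r\<close> to be nonnegative.\<close>
  define h where "h = 1 / (\<bar>r\<bar> + 1)"
  have h: "h > 0" "1 + h * r \<ge> 0" by (auto simp: h_def field_simps)
  have "x + h *\<^sub>R r *\<^sub>R x = (1 + h * r) *\<^sub>R x" by (simp add: algebra_simps)
  then have "norm (x + h *\<^sub>R r *\<^sub>R x) = (1 + h * r) * norm x"
    by (metis abs_of_nonneg h(2) norm_scaleR)
  then have "(norm (x + h *\<^sub>R r *\<^sub>R x) - norm x) / h = r * norm x"
    using h(1) by (simp add: algebra_simps)
  then show ?thesis
    using norm_deriv_le_quotient[OF h(1), of x "r *\<^sub>R x"] by simp
qed

lemma norm_deriv_zero [simp]: "norm_deriv x 0 = 0"
  by (simp add: norm_deriv_def)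

section \<open>Linear functionals on the complex plane below a sublinear functional\<close>

text \<open>
  This is the single extension step of the Hahn-Banach theorem: the functional \<open>s \<mapsto> s p(1)\<close> on the
  real axis lies below \<open>p\<close> and extends to the plane as \<open>c \<mapsto> Re (c v)\<close>. The real part of \<open>v\<close> is
  prescribed; its imaginary part may be any number between the two families of bounds that come from
  the lines \<open>Im c = 1\<close> and \<open>Im c = -1\<close>, and subadditivity says that these do not cross.
\<close>

lemma sublinear_complex_support:
  fixes p :: "complex \<Rightarrow> real"
  assumes add: "\<And>c d. p (c + d) \<le> p c + p d"
    and scale: "\<And>s c. s > 0 \<Longrightarrow> p (s *\<^sub>R c) = s * p c"
    and zero: "p 0 = 0"
  obtains v where "Re v = p 1" "\<And>c. Re (c * v) \<le> p c"
proof -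
  have real: "s * p 1 \<le> p (of_real s)" for s
  proof (cases s "0 :: real" rule: linorder_cases)
    case less
    have "p (of_real (-s)) = - s * p 1"
      using scale[of "- s" 1] less by (simp add: scaleR_conv_of_real)
    moreover have "0 \<le> p (of_real s) + p (of_real (-s))"
      using add[of "of_real s" "of_real (-s)"] zero by simp
    ultimately show ?thesis by simp
  qed (use zero scale[of s 1] in \<open>simp_all add: scaleR_conv_of_real\<close>)
  have sep: "s * p 1 - p (Complex s 1) \<le> p (Complex t (-1)) - t * p 1" for s t
  proof -
    have "(s + t) * p 1 \<le> p (Complex s 1 + Complex t (-1))"
      using real[of "s + t"] by (simp add: complex_of_real_def complex_add)
    also have "\<dots> \<le> p (Complex s 1) + p (Complex t (-1))" by (rule add)
    finally show ?thesis by (simp add: algebra_simps)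
  qed
  define b where "b = (SUP s. s * p 1 - p (Complex s 1))"
  have lower: "s * p 1 - p (Complex s 1) \<le> b" for s
    unfolding b_def by (rule cSUP_upper) (auto intro!: bdd_aboveI2 sep[where t = 0])
  have upper: "b \<le> p (Complex t (-1)) - t * p 1" for t
    unfolding b_def by (rule cSUP_least) (auto intro: sep)
  have "Re (c * Complex (p 1) b) \<le> p c" for c
  proof (cases "Im c" "0 :: real" rule: linorder_cases)
    case less
    have "c = (- Im c) *\<^sub>R Complex (Re c / - Im c) (-1)"
      using less by (simp add: complex_eq_iff)
    then have "p c = (- Im c) * p (Complex (Re c / - Im c) (-1))"
      using scale[of "- Im c" "Complex (Re c / - Im c) (-1)"] less by (metis neg_0_less_iff_less)
    moreover have "(- Im c) * b \<le> (- Im c) * (p (Complex (Re c / - Im c) (-1)) - Re c / - Im c * p 1)"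
      by (intro mult_left_mono upper) (use less in simp)
    ultimately show ?thesis
      using less by (simp add: algebra_simps)
  next
    case equal
    then have "c = of_real (Re c)" by (simp add: complex_eq_iff)
    then show ?thesis using real[of "Re c"] equal by simp
  next
    case greater
    have "c = Im c *\<^sub>R Complex (Re c / Im c) 1"
      using greater by (simp add: complex_eq_iff)
    then have "p c = Im c * p (Complex (Re c / Im c) 1)"
      using scale[of "Im c" "Complex (Re c / Im c) 1"] greater by metis
    moreover have "Im c * (Re c / Im c * p 1 - p (Complex (Re c / Im c) 1)) \<le> Im c * b"
      by (intro mult_left_mono lower) (use greater in simp)
    ultimately show ?thesis
      using greater by (simp add: algebra_simps)
  qed
  then show thesis by (intro that[of "Complex (p 1) b"]) simp_all
qed

section \<open>Generators and rescaled semigroups\<close>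

lemma C0_semigroupD:
  assumes "C0_semigroup T"
  shows C0_semigroup_bounded_linear: "t \<ge> 0 \<Longrightarrow> bounded_linear (T t)"
    and C0_semigroup_scaleC: "t \<ge> 0 \<Longrightarrow> T t (c *\<^sub>C x) = c *\<^sub>C T t x"
    and C0_semigroup_zero: "T 0 x = x"
    and C0_semigroup_add: "s \<ge> 0 \<Longrightarrow> t \<ge> 0 \<Longrightarrow> T (s + t) x = T s (T t x)"
    and C0_semigroup_continuous_on: "continuous_on {0..} (\<lambda>t. T t x)"
  using assms by (auto simp: C0_semigroup_def bounded_clinear_def)

lemma generates_tendsto:
  "generates D A T \<Longrightarrow> x \<in> D \<Longrightarrow> ((\<lambda>t. (1 / t) *\<^sub>R (T t x - x)) \<longlongrightarrow> A x) (at_right 0)"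
  by (auto simp: generates_def)

lemma generates_memI:
  assumes "generates D A T" "((\<lambda>t. (1 / t) *\<^sub>R (T t x - x)) \<longlongrightarrow> y) (at_right 0)"
  shows "x \<in> D" "A x = y"
proof -
  show "x \<in> D" using assms by (auto simp: generates_def)
  then show "A x = y"
    using generates_tendsto[OF assms(1)] assms(2)
    by (intro tendsto_unique[of "at_right 0"]) auto
qed

lemma C0_semigroup_rescale:
  assumes "C0_semigroup T"
  shows "C0_semigroup (\<lambda>t x. exp (- z * of_real t) *\<^sub>C T t x)"
  unfolding C0_semigroup_def
proof (intro conjI allI impI)
  show "bounded_clinear (\<lambda>x. exp (- z * of_real t) *\<^sub>C T t x)" if "t \<ge> 0" for t
    unfolding bounded_clinear_def
    using bounded_linear_compose[OF bounded_linear_scaleC C0_semigroup_bounded_linear[OF assms that]]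
    by (simp add: C0_semigroup_scaleC[OF assms that] scaleC_scaleC mult.commute)
  show "(\<lambda>x. exp (- z * of_real 0) *\<^sub>C T 0 x) = id"
    by (simp add: C0_semigroup_zero[OF assms] fun_eq_iff)
  show "(\<lambda>x. exp (- z * of_real (s + t)) *\<^sub>C T (s + t) x) =
      (\<lambda>x. exp (- z * of_real s) *\<^sub>C T s x) \<circ> (\<lambda>x. exp (- z * of_real t) *\<^sub>C T t x)"
    if "s \<ge> 0" "t \<ge> 0" for s t
    using that
    by (simp add: fun_eq_iff C0_semigroup_add[OF assms] C0_semigroup_scaleC[OF assms]
          scaleC_scaleC distrib_left exp_diff exp_minus exp_add field_simps)
  show "continuous_on {0..} (\<lambda>t. exp (- z * of_real t) *\<^sub>C T t x)" for x
    by (intro scaleC.continuous_on C0_semigroup_continuous_on[OF assms] continuous_intros)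
qed

lemma tendsto_exp_quotient:
  "((\<lambda>t. (exp (z * of_real t) - 1) / of_real t) \<longlongrightarrow> (z :: complex)) (at_right 0)"
proof -
  have "((\<lambda>w. exp (z * w)) has_field_derivative z) (at 0)"
    by (auto intro!: derivative_eq_intros)
  then have "((\<lambda>w. (exp (z * w) - 1) / w) \<longlongrightarrow> z) (at 0)"
    by (simp add: has_field_derivative_iff)
  moreover have "filterlim (of_real :: real \<Rightarrow> complex) (at 0) (at_right 0)"
    by (auto simp: filterlim_at eventually_at_filter intro!: tendsto_eq_intros)
  ultimately show ?thesis by (rule filterlim_compose)
qed

text \<open>
  The product rule at \<open>t = 0\<close>. It is used with \<open>z\<close> and with \<open>-z\<close>, to pass to a rescaled semigroup
  and back.
\<close>

lemma tendsto_rescaled_quotient: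
  fixes F :: "real \<Rightarrow> 'a::complex_banach"
  assumes "((\<lambda>t. (1 / t) *\<^sub>R (F t - x)) \<longlongrightarrow> y) (at_right 0)"
  shows "((\<lambda>t. (1 / t) *\<^sub>R (exp (z * of_real t) *\<^sub>C F t - x)) \<longlongrightarrow> y + z *\<^sub>C x) (at_right 0)"
proof -
  have "((\<lambda>t. exp (z * of_real t)) \<longlongrightarrow> 1) (at_right (0::real))"
    by (auto intro!: tendsto_eq_intros)
  from tendsto_add[OF scaleC.tendsto[OF this assms] scaleC.tendsto[OF tendsto_exp_quotient tendsto_const]]
  have "((\<lambda>t. exp (z * of_real t) *\<^sub>C (1 / t) *\<^sub>R (F t - x)
      + ((exp (z * of_real t) - 1) / of_real t) *\<^sub>C x) \<longlongrightarrow> y + z *\<^sub>C x) (at_right 0)"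
    by simp
  moreover have "exp (z * of_real t) *\<^sub>C (1 / t) *\<^sub>R (F t - x)
      + ((exp (z * of_real t) - 1) / of_real t) *\<^sub>C x
      = (1 / t) *\<^sub>R (exp (z * of_real t) *\<^sub>C F t - x)" for t :: real
    by (simp add: scaleR_scaleC[where 'a = 'a] scaleC_scaleC scaleC.diff_right scaleC.diff_left diff_divide_distrib)
  ultimately show ?thesis by simp
qed

lemma generates_rescale:
  fixes T :: "real \<Rightarrow> 'a::complex_banach \<Rightarrow> 'a"
  assumes "generates D A T"
  shows "generates D (\<lambda>x. A x - z *\<^sub>C x) (\<lambda>t x. exp (- z * of_real t) *\<^sub>C T t x)"
proof -
  let ?S = "\<lambda>t x. exp (- z * of_real t) *\<^sub>C T t x"
  have fwd: "((\<lambda>t. (1 / t) *\<^sub>R (?S t x - x)) \<longlongrightarrow> A x - z *\<^sub>C x) (at_right 0)" if "x \<in> D" for x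
    using tendsto_rescaled_quotient[OF generates_tendsto[OF assms that], of "- z"]
    by (simp add: scaleC.minus_left)
  have bwd: "x \<in> D" if "((\<lambda>t. (1 / t) *\<^sub>R (?S t x - x)) \<longlongrightarrow> y) (at_right 0)" for x y
  proof -
    have "exp (z * of_real t) *\<^sub>C ?S t x = T t x" for t
      by (simp add: scaleC_scaleC exp_minus)
    with tendsto_rescaled_quotient[OF that, of z] show "x \<in> D"
      by (intro generates_memI(1)[OF assms, of _ "y + z *\<^sub>C x"]) (simp only:)
  qed
  show ?thesis unfolding generates_def
  proof (intro conjI ballI set_eqI iffI)
    show "x \<in> {x. \<exists>y. ((\<lambda>t. (1 / t) *\<^sub>R (?S t x - x)) \<longlongrightarrow> y) (at_right 0)}" if "x \<in> D" for x
      using fwd[OF that] by (intro CollectI exI)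
    show "x \<in> D" if "x \<in> {x. \<exists>y. ((\<lambda>t. (1 / t) *\<^sub>R (?S t x - x)) \<longlongrightarrow> y) (at_right 0)}" for x
      using that by (elim CollectE exE bwd)
  qed (rule fwd)
qed

lemma C0_semigroup_maps_domain:
  assumes "C0_semigroup T" "generates D A T" "t \<ge> 0" "x \<in> D"
  shows "T t x \<in> D"
proof -
  interpret Tt: bounded_linear "T t" by (rule C0_semigroup_bounded_linear[OF assms(1,3)])
  have "((\<lambda>h. T t ((1 / h) *\<^sub>R (T h x - x))) \<longlongrightarrow> T t (A x)) (at_right 0)"
    by (rule Tt.tendsto[OF generates_tendsto[OF assms(2,4)]])
  moreover have "\<forall>\<^sub>F h in at_right 0. T t ((1 / h) *\<^sub>R (T h x - x)) = (1 / h) *\<^sub>R (T h (T t x) - T t x)"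
  proof (rule eventually_at_rightI[of 0 1])
    fix h :: real assume "h \<in> {0<..<1}"
    then have "T t (T h x) = T h (T t x)"
      using C0_semigroup_add[OF assms(1), of t h x] C0_semigroup_add[OF assms(1), of h t x] assms(3)
      by (simp add: add.commute)
    then show "T t ((1 / h) *\<^sub>R (T h x - x)) = (1 / h) *\<^sub>R (T h (T t x) - T t x)"
      by (simp add: Tt.scaleR Tt.diff)
  qed simp
  ultimately have "((\<lambda>h. (1 / h) *\<^sub>R (T h (T t x) - T t x)) \<longlongrightarrow> T t (A x)) (at_right 0)"
    by (rule Lim_transform_eventually)
  then show ?thesis by (rule generates_memI(1)[OF assms(2)])
qed

section \<open>Resolvent estimates from growth of the semigroup\<close>

lemma tendsto_integral_average:
  fixes f :: "real \<Rightarrow> 'a::banach"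
  assumes "continuous_on {a..} f" "c \<ge> a"
  shows "((\<lambda>h. (1 / h) *\<^sub>R integral {c..c + h} f) \<longlongrightarrow> f c) (at_right 0)"
proof (rule tendstoI)
  fix e :: real assume "e > 0"
  obtain d where "d > 0" and d: "\<And>t. t \<ge> a \<Longrightarrow> dist t c < d \<Longrightarrow> dist (f t) (f c) < e / 2"
    using assms half_gt_zero[OF \<open>e > 0\<close>] unfolding continuous_on_iff by (metis atLeast_iff)
  show "\<forall>\<^sub>F h in at_right 0. dist ((1 / h) *\<^sub>R integral {c..c + h} f) (f c) < e"
  proof (rule eventually_at_rightI[OF _ \<open>d > 0\<close>])
    fix h assume h: "h \<in> {0<..<d}"
    have int: "f integrable_on {c..c + h}"
      by (intro integrable_continuous_real continuous_on_subset[OF assms(1)]) (use assms(2) in auto)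
    have cont: "continuous_on {c..c + h} f"
      by (rule continuous_on_subset[OF assms(1)]) (use assms(2) in auto)
    have near: "norm (f t - f c) \<le> e / 2" if "t \<in> {c..c + h}" for t
    proof -
      have "t \<ge> a" "dist t c < d" using that h assms(2) by (auto simp: dist_real_def)
      from d[OF this] show ?thesis unfolding dist_norm by (rule less_imp_le)
    qed
    have "norm (integral {c..c + h} (\<lambda>t. f t - f c)) \<le> e / 2 * (c + h - c)"
      by (rule integral_bound[OF _ continuous_on_diff[OF cont continuous_on_const] near]) (use h in auto)
    then have "norm (integral {c..c + h} f - h *\<^sub>R f c) \<le> e / 2 * h"
      using h by (simp add: integral_diff[OF int integrable_const_ivl])
    moreover have "(1 / h) *\<^sub>R integral {c..c + h} f - f c
        = (1 / h) *\<^sub>R (integral {c..c + h} f - h *\<^sub>R f c)"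
      using h by (simp add: scaleR_diff_right)
    ultimately have "dist ((1 / h) *\<^sub>R integral {c..c + h} f) (f c) \<le> e / 2"
      using h by (simp add: dist_norm pos_divide_le_eq)
    then show "dist ((1 / h) *\<^sub>R integral {c..c + h} f) (f c) < e"
      using \<open>e > 0\<close> by simp
  qed
qed

text \<open>
  Applying \<open>T h\<close> shifts the window of integration from \<open>[0, b]\<close> to \<open>[h, b + h]\<close>, so the difference
  consists of two end pieces of length \<open>h\<close>, whose averages converge to the end values of the orbit.
\<close>

lemma generator_integral:
  fixes T :: "real \<Rightarrow> 'a::complex_banach \<Rightarrow> 'a"
  assumes "C0_semigroup T" "generates D A T" "b \<ge> 0"
  shows "integral {0..b} (\<lambda>t. T t x) \<in> D"
    and "A (integral {0..b} (\<lambda>t. T t x)) = T b x - x"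
proof -
  let ?f = "\<lambda>t. T t x" and ?J = "integral {0..b} (\<lambda>t. T t x)"
  note cont = C0_semigroup_continuous_on[OF assms(1), of x]
  have int: "?f integrable_on {c..d}" if "c \<ge> 0" for c d
    by (intro integrable_continuous_real continuous_on_subset[OF cont]) (use that in auto)
  have shift: "T h ?J - ?J = integral {b..b + h} ?f - integral {0..0 + h} ?f" if "h > 0" for h
  proof -
    interpret Th: bounded_linear "T h" by (rule C0_semigroup_bounded_linear[OF assms(1)]) (use that in simp)
    have "T h ?J = integral {0..b} (T h \<circ> ?f)"
      by (rule integral_linear[symmetric]) (auto intro: int Th.bounded_linear_axioms)
    also have "\<dots> = integral {0..b} (?f \<circ> (+) h)"
      by (rule integral_cong) (use that in \<open>simp add: C0_semigroup_add[OF assms(1)]\<close>)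
    also have "\<dots> = integral {h..b + h} ?f"
      by (simp add: integral_shift_Icc_real)
    finally have "T h ?J = integral {h..b + h} ?f" .
    moreover have "integral {h..b + h} ?f = integral {0..b + h} ?f - integral {0..0 + h} ?f"
      using Henstock_Kurzweil_Integration.integral_combine[where a = 0 and c = h and b = "b + h" and f = ?f] that assms(3) int[of 0 "b + h"] by (simp add: eq_diff_eq add.commute)
    moreover have "?J = integral {0..b + h} ?f - integral {b..b + h} ?f"
      using Henstock_Kurzweil_Integration.integral_combine[where a = 0 and c = b and b = "b + h" and f = ?f] that assms(3) int[of 0 "b + h"] by (simp add: eq_diff_eq)
    ultimately show ?thesis by simp
  qed
  have "((\<lambda>h. (1 / h) *\<^sub>R integral {b..b + h} ?f - (1 / h) *\<^sub>R integral {0..0 + h} ?f)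
      \<longlongrightarrow> T b x - T 0 x) (at_right 0)"
    using assms(3) by (intro tendsto_diff tendsto_integral_average[OF cont]) simp_all
  moreover have "\<forall>\<^sub>F h in at_right 0. (1 / h) *\<^sub>R integral {b..b + h} ?f - (1 / h) *\<^sub>R integral {0..0 + h} ?f
      = (1 / h) *\<^sub>R (T h ?J - ?J)"
    by (rule eventually_at_rightI[of 0 1]) (simp_all only: shift scaleR_diff_right greaterThanLessThan_iff zero_less_one)
  ultimately have "((\<lambda>h. (1 / h) *\<^sub>R (T h ?J - ?J)) \<longlongrightarrow> T b x - x) (at_right 0)"
    unfolding C0_semigroup_zero[OF assms(1)] by (rule Lim_transform_eventually)
  from generates_memI[OF assms(2) this] show "?J \<in> D" "A ?J = T b x - x" .
qed

text \<open>Neumann series.\<close>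

lemma surj_minus_of_norm_less_one:
  fixes S :: "'a::banach \<Rightarrow> 'a"
  assumes "bounded_linear S" "q < 1" "\<And>x. norm (S x) \<le> q * norm x"
  obtains x where "x - S x = y"
proof -
  interpret S: bounded_linear S by fact
  have q: "max q 0 < 1" "max q 0 \<ge> 0" using assms(2) by auto
  have bound: "norm ((S ^^ n) y) \<le> max q 0 ^ n * norm y" for n
  proof (induction n)
    case (Suc n)
    have "norm (S ((S ^^ n) y)) \<le> max q 0 * norm ((S ^^ n) y)"
      by (rule order_trans[OF assms(3)]) (simp add: mult_right_mono)
    also have "\<dots> \<le> max q 0 * (max q 0 ^ n * norm y)"
      by (intro mult_left_mono Suc q)
    finally show ?case by (simp add: mult.assoc)
  qed simp
  have summable: "summable (\<lambda>n. (S ^^ n) y)"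
    by (rule summable_comparison_test[of _ "\<lambda>n. max q 0 ^ n * norm y"])
       (use bound q in \<open>auto intro!: summable_mult2 summable_geometric\<close>)
  define x where "x = (\<Sum>n. (S ^^ n) y)"
  have "S x = (\<Sum>n. (S ^^ Suc n) y)"
    unfolding x_def by (simp add: S.suminf[OF summable])
  also have "\<dots> = x - y"
    unfolding x_def using suminf_split_head[OF summable] by simp
  finally show thesis by (intro that[of x]) simp
qed

text \<open>
  Since \<open>A\<close> maps the integral of the orbit of \<open>w\<close> over \<open>[0, 1]\<close> to \<open>T 1 w - w\<close>, surjectivity of
  \<open>A\<close> follows from that of \<open>T 1 - I\<close>. A finite interval replaces the Laplace transform, and no
  improper integral has to converge.
\<close>

lemma generator_surj:
  fixes T :: "real \<Rightarrow> 'a::complex_banach \<Rightarrow> 'a"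
  assumes "C0_semigroup T" "generates D A T"
    and "q < 1" "\<And>x. norm (T 1 x) \<le> q * norm x"
  obtains x where "x \<in> D" "A x = y"
proof -
  obtain w where "w - T 1 w = - y"
    using surj_minus_of_norm_less_one C0_semigroup_bounded_linear[OF assms(1)] assms(3,4)
    by (metis zero_le_one)
  then have "T 1 w - w = y" by (metis minus_diff_eq minus_minus)
  then show thesis
    using that generator_integral[OF assms(1,2) zero_le_one, of w] by simp
qed

text \<open>
  The quotient \<open>(T t x - x) / t\<close> has norm at least \<open>(1 - e\<^sup>-\<^sup>d\<^sup>t) / t\<close> times the norm of \<open>x\<close>; both
  sides have a limit at \<open>t = 0\<close>.
\<close>

lemma generator_norm_ge:
  fixes T :: "real \<Rightarrow> 'a::complex_banach \<Rightarrow> 'a"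
  assumes "generates D A T" "x \<in> D"
    and decay: "\<And>t. t \<ge> 0 \<Longrightarrow> norm (T t x) \<le> exp (- d * t) * norm x"
  shows "d * norm x \<le> norm (A x)"
proof (rule tendsto_le[of "at_right (0::real)"])
  show "((\<lambda>t. norm ((1 / t) *\<^sub>R (T t x - x))) \<longlongrightarrow> norm (A x)) (at_right 0)"
    by (rule tendsto_norm[OF generates_tendsto[OF assms(1,2)]])
  have "((\<lambda>t. exp (- d * t)) has_field_derivative - d) (at 0)"
    by (auto intro!: derivative_eq_intros)
  then have "((\<lambda>t. (exp (- d * t) - 1) / t) \<longlongrightarrow> - d) (at_right 0)"
    by (simp add: has_field_derivative_iff filterlim_at_split)
  then have "((\<lambda>t. - ((exp (- d * t) - 1) / t) * norm x) \<longlongrightarrow> - (- d) * norm x) (at_right 0)"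
    by (intro tendsto_intros)
  then show "((\<lambda>t. (1 - exp (- d * t)) / t * norm x) \<longlongrightarrow> d * norm x) (at_right 0)"
    by (simp add: minus_divide_left)
  show "\<forall>\<^sub>F t in at_right 0. (1 - exp (- d * t)) / t * norm x \<le> norm ((1 / t) *\<^sub>R (T t x - x))"
  proof (rule eventually_at_rightI[of 0 1])
    fix t :: real assume t: "t \<in> {0<..<1}"
    have "norm x - norm (T t x) \<le> norm (T t x - x)"
      by (metis norm_minus_commute norm_triangle_ineq2)
    with decay[of t] t have "norm x - exp (- d * t) * norm x \<le> norm (T t x - x)" by simp
    then have "(norm x - exp (- d * t) * norm x) / t \<le> norm (T t x - x) / t"
      using t by (intro divide_right_mono) auto
    then show "(1 - exp (- d * t)) / t * norm x \<le> norm ((1 / t) *\<^sub>R (T t x - x))"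
      using t by (simp add: left_diff_distrib)
  qed simp
qed simp

text \<open>
  The easy half of the Hille-Yosida theorem. The semigroup rescaled by \<open>e\<^sup>-\<^sup>z\<^sup>t\<close> decays at
  the rate \<open>Re z - \<omega>\<close>: decay at time \<open>1\<close> makes \<open>z - A\<close> surjective, and the lower bound on \<open>z - A\<close>
  gives both injectivity and the norm of the inverse.
\<close>

lemma resolvent_of_exponential_bound:
  fixes T :: "real \<Rightarrow> 'a::complex_banach \<Rightarrow> 'a"
  assumes "linear_operator D A" "C0_semigroup T" "generates D A T"
    and bound: "\<And>t x. t \<ge> 0 \<Longrightarrow> norm (T t x) \<le> exp (t * \<omega>) * norm x"
    and "Re z > \<omega>"
  shows "z \<in> resolvent_set D A" and "onorm (resolvent D A z) \<le> 1 / (Re z - \<omega>)"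
proof -
  let ?S = "\<lambda>t x. exp (- z * of_real t) *\<^sub>C T t x" and ?B = "\<lambda>x. z *\<^sub>C x - A x"
  let ?d = "Re z - \<omega>"
  note S = C0_semigroup_rescale[OF assms(2), of z]
  note gen = generates_rescale[OF assms(3), of z]
  have decay: "norm (?S t x) \<le> exp (- ?d * t) * norm x" if "t \<ge> 0" for t x
  proof -
    have "norm (?S t x) = exp (- Re z * t) * norm (T t x)"
      by (simp add: norm_scaleC norm_exp_eq_Re)
    also have "\<dots> \<le> exp (- Re z * t) * (exp (t * \<omega>) * norm x)"
      by (intro mult_left_mono bound that) simp
    also have "\<dots> = exp (- ?d * t) * norm x"
      by (simp add: algebra_simps flip: exp_add)
    finally show ?thesis .
  qed
  have lower: "?d * norm x \<le> norm (?B x)" if "x \<in> D" for x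
    using generator_norm_ge[OF gen that, of ?d] decay by (simp add: norm_minus_commute)
  have B_diff: "?B (x - y) = ?B x - ?B y" "x - y \<in> D" if "x \<in> D" "y \<in> D" for x y
  proof -
    have "-1 *\<^sub>C y \<in> D" "A (-1 *\<^sub>C y) = -1 *\<^sub>C A y"
      using assms(1) that unfolding linear_operator_def by blast+
    then have *: "- y \<in> D" "A (- y) = - A y" by (simp_all add: scaleC.minus_left)
    then have "x + - y \<in> D" "A (x + - y) = A x + A (- y)"
      using assms(1) that unfolding linear_operator_def by blast+
    with * show "?B (x - y) = ?B x - ?B y" "x - y \<in> D" by (simp_all add: scaleC.diff_right)
  qed
  have inj: "inj_on ?B D"
  proof (rule inj_onI)
    fix x y assume xy: "x \<in> D" "y \<in> D" "?B x = ?B y"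
    then have "?d * norm (x - y) \<le> 0" using lower[OF B_diff(2)[OF xy(1,2)]] B_diff(1)[OF xy(1,2)] by simp
    then show "x = y" using assms(5) by (simp add: mult_le_0_iff)
  qed
  have surj: "\<exists>x\<in>D. ?B x = y" for y
  proof -
    obtain x where "x \<in> D" "A x - z *\<^sub>C x = - y"
      using generator_surj[OF S gen, of "exp (- ?d)" "- y"] decay[of 1] assms(5) by auto
    then show ?thesis by (metis minus_diff_eq minus_minus)
  qed
  have bij: "bij_betw ?B D UNIV"
    unfolding bij_betw_def
  proof (intro conjI inj set_eqI iffI UNIV_I)
    show "y \<in> ?B ` D" for y using surj[of y] by (elim bexE) (rule image_eqI, rule sym)
  qed
  define R where "R = resolvent D A z"
  have R: "R y \<in> D" "?B (R y) = y" for y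
    using bij the_inv_into_into[OF inj, of y D] f_the_inv_into_f[OF inj, of y]
    by (auto simp: R_def resolvent_def bij_betw_def)
  have R_B: "R (?B x) = x" if "x \<in> D" for x
    using the_inv_into_f_f[OF inj that] by (simp add: R_def resolvent_def)
  have R_norm: "norm (R y) \<le> 1 / ?d * norm y" for y
    using lower[OF R(1), of y] R(2)[of y] assms(5) by (simp add: field_simps)
  have R_add: "R (x + y) = R x + R y" for x y
  proof -
    have "R x + R y \<in> D" "A (R x + R y) = A (R x) + A (R y)"
      using assms(1) R(1) unfolding linear_operator_def by blast+
    then have "?B (R x + R y) = ?B (R x) + ?B (R y)"
      by (simp add: scaleC_add_right add_diff_add)
    then have "R (?B (R x + R y)) = R (x + y)" by (simp only: R(2))
    then show ?thesis using R_B \<open>R x + R y \<in> D\<close> by simp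
  qed
  have R_scale: "R (c *\<^sub>C x) = c *\<^sub>C R x" for c x
  proof -
    have "c *\<^sub>C R x \<in> D" "A (c *\<^sub>C R x) = c *\<^sub>C A (R x)"
      using assms(1) R(1) unfolding linear_operator_def by blast+
    then have "?B (c *\<^sub>C R x) = c *\<^sub>C ?B (R x)"
      by (simp add: scaleC.diff_right scaleC_scaleC mult.commute)
    then have "R (?B (c *\<^sub>C R x)) = R (c *\<^sub>C x)" by (simp only: R(2))
    then show ?thesis using R_B \<open>c *\<^sub>C R x \<in> D\<close> by simp
  qed
  have "bounded_linear R"
    by (rule bounded_linear_intro[where K = "1 / ?d"])
       (use R_norm in \<open>simp_all add: R_add R_scale scaleR_scaleC mult.commute\<close>)
  then show "z \<in> resolvent_set D A"
    using bij R_scale by (simp add: resolvent_set_def bounded_clinear_def R_def)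
  show "onorm (resolvent D A z) \<le> 1 / ?d"
    using R_norm assms(5) by (intro onorm_bound) (simp_all add: R_def)
qed

section \<open>Half planes\<close>

lemma cis_mult_cancel [simp]: "cis (- \<theta>) * (cis \<theta> * w) = w" "cis \<theta> * (cis (- \<theta>) * w) = w"
  by (simp_all add: cis_mult flip: mult.assoc)

lemma mem_half_plane_iff: "z \<in> half_plane \<theta> \<omega> \<longleftrightarrow> Re (cis (- \<theta>) * z) > \<omega>"
proof
  assume "z \<in> half_plane \<theta> \<omega>"
  then obtain w where "z = cis \<theta> * w" "Re w > \<omega>"
    by (auto simp: half_plane_def cis_conv_exp)
  then show "Re (cis (- \<theta>) * z) > \<omega>" by (simp del: times_complex.sel)
next
  assume "Re (cis (- \<theta>) * z) > \<omega>"
  then have "\<exists>w. z = cis \<theta> * w \<and> Re w > \<omega>"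
    by (intro exI[of _ "cis (- \<theta>) * z"]) simp
  then show "z \<in> half_plane \<theta> \<omega>"
    by (simp add: half_plane_def cis_conv_exp)
qed

lemma Re_cis_uminus_mult: "Re (cis (- \<theta>) * z) = cis \<theta> \<bullet> z"
  by (simp add: inner_complex_def)

lemma frontier_half_plane: "frontier (half_plane \<theta> \<omega>) = {z. Re (cis (- \<theta>) * z) = \<omega>}"
proof -
  have "half_plane \<theta> \<omega> = {z. cis \<theta> \<bullet> z > \<omega>}"
    unfolding mem_half_plane_iff[symmetric] Re_cis_uminus_mult[symmetric] by simp
  then show ?thesis
    by (simp only: frontier_halfspace_gt[OF disjI1[OF cis_neq_zero]] Re_cis_uminus_mult)
qed

lemma infdist_frontier_half_plane:
  assumes "z \<in> half_plane \<theta> \<omega>"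
  shows "infdist z (frontier (half_plane \<theta> \<omega>)) = Re (cis (- \<theta>) * z) - \<omega>"
    (is "infdist z ?F = ?d")
proof (rule antisym)
  define m where "m = z - cis \<theta> * of_real ?d"
  have "cis (- \<theta>) * m = cis (- \<theta>) * z - of_real ?d"
    unfolding m_def right_diff_distrib cis_mult_cancel ..
  then have "Re (cis (- \<theta>) * m) = \<omega>"
    by (simp only: minus_complex.sel Re_complex_of_real)
  then have m: "m \<in> ?F" by (simp only: frontier_half_plane mem_Collect_eq)
  have "dist z m = \<bar>?d\<bar>"
    by (simp only: m_def dist_norm diff_diff_eq2 add_diff_cancel_left' norm_mult norm_cis norm_of_real mult_1)
  then show "infdist z ?F \<le> ?d"
    using infdist_le[OF m, of z] assms by (simp only: mem_half_plane_iff abs_of_pos diff_gt_0_iff_gt)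
  have "?d \<le> dist z w" if "w \<in> ?F" for w
  proof -
    have "?d = Re (cis (- \<theta>) * (z - w))"
      using that by (simp only: frontier_half_plane mem_Collect_eq right_diff_distrib minus_complex.sel)
    also have "\<dots> \<le> cmod (cis (- \<theta>) * (z - w))" by (rule complex_Re_le_cmod)
    also have "\<dots> = dist z w" by (simp add: norm_mult dist_norm)
    finally show ?thesis .
  qed
  with m show "?d \<le> infdist z ?F"
    by (subst infdist_notempty) (auto intro!: cINF_greatest)
qed

section \<open>The numerical spectrum and dissipativity\<close>

text \<open>
  With \<open>B = e\<^sup>-\<^sup>i\<^sup>\<theta> A - \<omega>\<close> the resolvent estimate says that \<open>K\<^sub>h = (I - h B)\<^sup>-\<^sup>1\<close> is a
  contraction for every \<open>h > 0\<close>. On \<open>D\<close> one has \<open>x + h B x = K\<^sub>h x + h (B x - K\<^sub>h B x)\<close>, and density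
  of \<open>D\<close> makes \<open>K\<^sub>h\<close> converge strongly to the identity; so the norm of \<open>x + h B x\<close> exceeds that of
  \<open>x\<close> by \<open>o(h)\<close> only. This is stronger than the bound on the norm of \<open>x - h B x\<close>
  that the estimate gives directly: that one controls some duality functional of \<open>x\<close>, this
  one controls all of them.
\<close>

lemma norm_deriv_le_of_half_plane:
  fixes A :: "'a::complex_banach \<Rightarrow> 'a"
  assumes "linear_operator D A" "densely_defined D"
    and sub: "half_plane \<theta> \<omega> \<subseteq> resolvent_set D A"
    and bound: "\<And>z. z \<in> half_plane \<theta> \<omega> \<Longrightarrow>
      onorm (resolvent D A z) \<le> 1 / infdist z (frontier (half_plane \<theta> \<omega>))"
    and "x \<in> D"
  shows "norm_deriv x (cis (- \<theta>) *\<^sub>C A x) \<le> \<omega> * norm x"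
proof -
  let ?e = "cis (- \<theta>)" and ?c = "cis \<theta>"
  define B where "B x = ?e *\<^sub>C A x - \<omega> *\<^sub>R x" for x
  define z where "z h = ?c * of_real (\<omega> + 1 / h)" for h
  define K where "K h y = resolvent D A (z h) ((?c * of_real (1 / h)) *\<^sub>C y)" for h y
  have Re_z: "Re (?e * z h) = \<omega> + 1 / h" for h
    by (simp only: z_def cis_mult_cancel Re_complex_of_real)
  have z_mem: "z h \<in> half_plane \<theta> \<omega>" if "h > 0" for h
    using that by (simp only: mem_half_plane_iff Re_z) simp
  have R_le: "onorm (resolvent D A (z h)) \<le> h" if "h > 0" for h
    using bound[OF z_mem[OF that]] unfolding infdist_frontier_half_plane[OF z_mem[OF that]] Re_z
    by simp
  have lin: "bounded_linear (resolvent D A (z h))" and inj: "inj_on (\<lambda>x. z h *\<^sub>C x - A x) D" if "h > 0" for h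
    using z_mem[OF that] sub by (auto simp: resolvent_set_def bounded_clinear_def bij_betw_def)
  have K_norm: "norm (K h y) \<le> norm y" if "h > 0" for h y
  proof -
    have "norm (K h y) \<le> onorm (resolvent D A (z h)) * norm ((?c * of_real (1 / h)) *\<^sub>C y)"
      unfolding K_def by (rule onorm[OF lin[OF that]])
    also have "\<dots> \<le> h * norm ((?c * of_real (1 / h)) *\<^sub>C y)"
      by (intro mult_right_mono R_le that) simp
    also have "\<dots> = norm y"
      using that by (simp add: norm_scaleC norm_mult norm_divide)
    finally show ?thesis .
  qed
  have K_diff: "K h (y - w) = K h y - K h w" if "h > 0" for h y w
    unfolding K_def by (simp add: scaleC.diff_right bounded_linear.linear[OF lin[OF that], THEN linear_diff])
  \<comment> \<open>That is, \<open>K h\<close> is a left inverse of \<open>I - h B\<close> on \<open>D\<close>.\<close>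
  have K_inv: "K h (y - h *\<^sub>R B y) = y" if "h > 0" "y \<in> D" for h y
  proof -
    have "(?c * of_real (1 / h)) *\<^sub>C (y - h *\<^sub>R B y) = z h *\<^sub>C y - A y"
    proof -
      have "(?c * of_real (1 / h)) *\<^sub>C h *\<^sub>R B y = ?c *\<^sub>C B y"
        using that by (simp add: scaleR_scaleC[where 'a = 'a] scaleC_scaleC)
      also have "\<dots> = A y - (?c * of_real \<omega>) *\<^sub>C y"
        by (simp add: B_def scaleC.diff_right scaleC_scaleC cis_mult scaleR_scaleC[where 'a = 'a])
      finally show ?thesis
        by (simp add: scaleC.diff_right z_def distrib_left scaleC_add_left)
    qed
    then show ?thesis
      unfolding K_def resolvent_def by (simp add: the_inv_into_f_f[OF inj[OF that(1)] that(2)])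
  qed
  have K_approx: "norm (K h y - y) \<le> h * norm (B y)" if "h > 0" "y \<in> D" for h y
  proof -
    have "K h y - y = K h (h *\<^sub>R B y)"
      using K_inv[OF that] K_diff[OF that(1), of y "y - h *\<^sub>R B y"] by simp
    then show ?thesis using K_norm[OF that(1), of "h *\<^sub>R B y"] that(1) by simp
  qed
  have "norm_deriv x (B x) \<le> 0"
  proof (rule field_le_epsilon)
    fix e :: real assume "e > 0"
    obtain y where y: "y \<in> D" "norm (y - B x) < e / 3"
      using assms(2) \<open>e > 0\<close> closure_approachable[of "B x" D]
      by (auto simp: densely_defined_def dist_norm dest!: spec[of _ "e / 3"])
    \<comment> \<open>Here \<open>B x\<close> need not lie in \<open>D\<close>: it is replaced by \<open>y\<close>, and \<open>h\<close> is adapted to \<open>y\<close>.\<close>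
    define h where "h = e / (3 * (norm (B y) + 1))"
    have h: "h > 0" "h * norm (B y) \<le> e / 3"
    proof -
      show "h > 0" using \<open>e > 0\<close> by (simp add: h_def add_nonneg_pos)
      have "h * norm (B y) \<le> h * (norm (B y) + 1)" using \<open>h > 0\<close> by (intro mult_left_mono) auto
      also have "\<dots> = e / 3"
        unfolding h_def using norm_ge_zero[of "B y"]
        by (subst times_divide_eq_left, subst nonzero_mult_divide_mult_cancel_right) linarith+
      finally show "h * norm (B y) \<le> e / 3" .
    qed
    have "norm (B x - K h (B x)) \<le> e"
    proof -
      have "B x - K h (B x) = (B x - y) + (y - K h y) + K h (y - B x)"
        by (simp add: K_diff[OF h(1)])
      then have "norm (B x - K h (B x)) \<le> norm (B x - y) + norm (y - K h y) + norm (K h (y - B x))"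
        by (metis norm_triangle_le norm_triangle_ineq add_mono order_refl)
      with K_approx[OF h(1) y(1)] K_norm[OF h(1), of "y - B x"] y(2) h(2)
      show ?thesis by (simp add: norm_minus_commute)
    qed
    moreover have "x + h *\<^sub>R B x = K h x + h *\<^sub>R (B x - K h (B x))"
    proof -
      have "K h (h *\<^sub>R B x) = h *\<^sub>R K h (B x)"
        unfolding K_def
        by (simp add: scaleC.scaleR_right bounded_linear.linear[OF lin[OF h(1)], THEN linear_scale])
      then show ?thesis
        using K_inv[OF h(1) assms(5)] by (simp add: K_diff[OF h(1)] algebra_simps)
    qed
    ultimately have "norm (x + h *\<^sub>R B x) \<le> norm x + h * e"
      using K_norm[OF h(1), of x] h(1)
      by (metis (no_types, opaque_lifting) abs_of_pos add_mono mult_left_mono norm_scaleR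
          norm_triangle_ineq order_less_imp_le order_trans)
    then have "(norm (x + h *\<^sub>R B x) - norm x) / h \<le> e"
      using h(1) by (simp add: pos_divide_le_eq mult.commute)
    then show "norm_deriv x (B x) \<le> 0 + e"
      using norm_deriv_le_quotient[OF h(1), of x "B x"] by simp
  qed
  then show ?thesis
    using norm_deriv_add_le[of x "B x" "\<omega> *\<^sub>R x"] norm_deriv_same_le[of x \<omega>]
    by (simp add: B_def)
qed

text \<open>
  Half planes in several directions may cover a point together with its surroundings although none
  of them is \<open>{Re z > \<omega>}\<close>, so the bounds for different angles have to be combined. A number \<open>v\<close> with
  \<open>Re (c v)\<close> below \<open>c \<mapsto> p\<^sub>x(c A x)\<close> respects all these bounds simultaneously; divided by the norm of
  \<open>x\<close> it therefore avoids every admissible half plane. It behaves like a value \<open>\<psi>(A x)\<close> of a duality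
  functional \<open>\<psi>\<close> of \<open>x\<close>, chosen with maximal real part.
\<close>

lemma norm_deriv_eq_numerical_spectrum:
  fixes A :: "'a::complex_banach \<Rightarrow> 'a"
  assumes "linear_operator D A" "densely_defined D" "x \<in> D" "x \<noteq> 0"
  obtains u where "u \<in> numerical_spectrum D A" "norm_deriv x (A x) = Re u * norm x"
proof -
  obtain v where v: "Re v = norm_deriv x (A x)" "\<And>c. Re (c * v) \<le> norm_deriv x (c *\<^sub>C A x)"
  proof (rule sublinear_complex_support[of "\<lambda>c. norm_deriv x (c *\<^sub>C A x)"])
    show "norm_deriv x ((c + d) *\<^sub>C A x) \<le> norm_deriv x (c *\<^sub>C A x) + norm_deriv x (d *\<^sub>C A x)" for c d
      unfolding scaleC_add_left by (rule norm_deriv_add_le)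
    show "norm_deriv x ((s *\<^sub>R c) *\<^sub>C A x) = s * norm_deriv x (c *\<^sub>C A x)" if "s > 0" for s c
      unfolding scaleC.scaleR_left by (rule norm_deriv_scaleR[OF that])
  qed (auto simp: scaleC.zero_left)
  define u where "u = v / of_real (norm x)"
  have u: "v = of_real (norm x) * u" using assms(4) by (simp add: u_def)
  have "u \<notin> half_plane \<theta> \<omega>"
    if "half_plane \<theta> \<omega> \<subseteq> resolvent_set D A"
      "\<forall>z\<in>half_plane \<theta> \<omega>. onorm (resolvent D A z) \<le> 1 / infdist z (frontier (half_plane \<theta> \<omega>))" for \<theta> \<omega>
  proof -
    let ?e = "cis (- \<theta>)"
    have "Re (of_real r * c) = r * Re c" for r c by simp
    then have "norm x * Re (?e * u) = Re (?e * v)"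
      by (simp only: u mult.left_commute[of ?e])
    also have "\<dots> \<le> norm_deriv x (?e *\<^sub>C A x)" by (rule v(2))
    also have "\<dots> \<le> \<omega> * norm x"
      using that by (intro norm_deriv_le_of_half_plane[OF assms(1,2) _ _ assms(3)]) auto
    finally show ?thesis
      using assms(4) by (simp add: mem_half_plane_iff not_less mult.commute[of \<omega>] del: times_complex.sel)
  qed
  then have "u \<in> numerical_spectrum D A"
    by (auto simp: numerical_spectrum_def numerical_resolvent_set_def)
  moreover have "norm_deriv x (A x) = Re u * norm x"
    using v(1) u by (simp add: mult.commute)
  ultimately show thesis by (rule that)
qed

section \<open>Dissipative generators\<close>

text \<open>
  A mean value inequality for an upper right Dini derivative. Only eventual inequalities are available,
  so the points up to which \<open>g\<close> stays below the line of slope \<open>e\<close> are followed to their supremum: by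
  continuity the bound holds there too, and the hypothesis pushes it beyond unless the supremum is
  \<open>b\<close>.
\<close>

lemma right_slope_nonpos_imp_le:
  fixes g :: "real \<Rightarrow> real"
  assumes cont: "continuous_on {a..} g" and "a \<le> b"
    and slope: "\<And>t e. t \<ge> a \<Longrightarrow> e > 0 \<Longrightarrow> \<forall>\<^sub>F h in at_right 0. g (t + h) \<le> g t + e * h"
  shows "g b \<le> g a"
proof -
  have main: "g b \<le> g a + e * (b - a)" if "e > 0" for e
  proof -
    define S where "S = {t \<in> {a..b}. \<forall>u\<in>{a..t}. g u \<le> g a + e * (u - a)}"
    define s where "s = Sup S"
    have a: "a \<in> S" using assms(2) by (auto simp: S_def)
    have bdd: "bdd_above S" by (auto simp: S_def)
    have s: "a \<le> s" "s \<le> b"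
    proof -
      show "a \<le> s" unfolding s_def by (rule cSup_upper[OF a bdd])
      have "t \<le> b" if "t \<in> S" for t using that by (simp add: S_def)
      with a show "s \<le> b" unfolding s_def by (intro cSup_least) auto
    qed
    have below: "g u \<le> g a + e * (u - a)" if u: "u \<in> {a..<s}" for u
    proof -
      obtain t where "t \<in> S" "u < t"
        using less_cSupD[of S u] a u unfolding s_def by (metis atLeastLessThan_iff empty_iff)
      then show ?thesis using u unfolding S_def by force
    qed
    have at_s: "g s \<le> g a + e * (s - a)"
    proof (rule ccontr)
      let ?f = "\<lambda>u. g u - (g a + e * (u - a))"
      assume "\<not> ?thesis"
      then have pos: "?f s > 0" by simp
      then have "s \<noteq> a" by auto
      with s have "a < s" by simp
      have "continuous_on {a..} ?f" by (intro continuous_intros cont)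
      then have "(?f \<longlongrightarrow> ?f s) (at s within {a..})"
        using s(1) by (simp add: continuous_on_def)
      from order_tendstoD(1)[OF this pos]
      obtain d where "d > 0" and d: "\<And>u. u \<ge> a \<Longrightarrow> u \<noteq> s \<Longrightarrow> dist u s < d \<Longrightarrow> ?f u > 0"
        unfolding eventually_at by (metis atLeast_iff)
      define u where "u = max a (s - d / 2)"
      have "u \<ge> a" "u < s" "dist u s < d"
        using \<open>d > 0\<close> \<open>a < s\<close> by (auto simp: u_def dist_real_def)
      with d[of u] below[of u] show False by simp
    qed
    have "s = b"
    proof (rule ccontr)
      assume "s \<noteq> b"
      with s have "s < b" by simp
      obtain d where "d > 0" and d: "\<And>h. 0 < h \<Longrightarrow> h < d \<Longrightarrow> g (s + h) \<le> g s + e * h"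
        using slope[OF s(1) \<open>e > 0\<close>] by (auto simp: eventually_at_right[of 0 1])
      define t where "t = min b (s + d / 2)"
      have "g u \<le> g a + e * (u - a)" if u: "u \<in> {a..t}" for u
      proof (cases u s rule: linorder_cases)
        case greater
        have "u - s < d" using u \<open>d > 0\<close> by (simp add: t_def)
        with greater have "g u \<le> g s + e * (u - s)" using d[of "u - s"] by simp
        with at_s show ?thesis by (simp add: algebra_simps)
      qed (use below at_s u in simp_all)
      moreover have "t \<in> {a..b}" using s \<open>d > 0\<close> by (simp add: t_def)
      ultimately have "t \<in> S" unfolding S_def by blast
      then have "t \<le> s" unfolding s_def by (rule cSup_upper[OF _ bdd])
      moreover have "s < t" using \<open>s < b\<close> \<open>d > 0\<close> by (simp add: t_def)
      ultimately show False by simp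
    qed
    with at_s show ?thesis by simp
  qed
  show ?thesis
  proof (rule field_le_epsilon)
    fix e :: real assume "e > 0"
    define e' where "e' = e / (b - a + 1)"
    have "b - a + 1 > 0" using assms(2) by simp
    then have "e' > 0" "e' * (b - a + 1) = e"
      using \<open>e > 0\<close> by (simp_all add: e'_def)
    then have "e' > 0" "e' * (b - a) + e' = e" by (simp_all add: distrib_left)
    with main[of e'] show "g b \<le> g a + e" by linarith
  qed
qed

text \<open>
  The orbit stays in \<open>D\<close>, and at each of its points \<open>y\<close> the norm has the right derivative
  \<open>norm_deriv y (A y)\<close> along the orbit.
\<close>

lemma dissipative_generator_contraction:
  fixes T :: "real \<Rightarrow> 'a::complex_banach \<Rightarrow> 'a"
  assumes "C0_semigroup T" "generates D A T"
    and diss: "\<And>x. x \<in> D \<Longrightarrow> norm_deriv x (A x) \<le> 0"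
    and "x \<in> D" "t \<ge> 0"
  shows "norm (T t x) \<le> norm x"
proof -
  have "norm (T t x) \<le> norm (T 0 x)"
  proof (rule right_slope_nonpos_imp_le[OF _ assms(5)])
    show "continuous_on {0..} (\<lambda>t. norm (T t x))"
      by (intro continuous_on_norm C0_semigroup_continuous_on[OF assms(1)])
    fix s e :: real assume "s \<ge> 0" "e > 0"
    define y where "y = T s x"
    have "y \<in> D" unfolding y_def using C0_semigroup_maps_domain[OF assms(1,2) \<open>s \<ge> 0\<close> assms(4)] .
    then have "norm_deriv y (A y) < e / 2" using diss[of y] \<open>e > 0\<close> by simp
    then obtain k where "k > 0"
      and k: "\<And>h. 0 < h \<Longrightarrow> h \<le> k \<Longrightarrow> (norm (y + h *\<^sub>R A y) - norm y) / h < e / 2"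
      by (metis norm_deriv_less_imp_quotient_less)
    have "\<forall>\<^sub>F h in at_right 0. dist ((1 / h) *\<^sub>R (T h y - y)) (A y) < e / 2"
      by (rule tendstoD[OF generates_tendsto[OF assms(2) \<open>y \<in> D\<close>]]) (use \<open>e > 0\<close> in simp)
    moreover have "\<forall>\<^sub>F h in at_right 0. h \<in> {0<..<k}"
      by (rule eventually_at_rightI[OF _ \<open>k > 0\<close>])
    ultimately show "\<forall>\<^sub>F h in at_right 0. norm (T (s + h) x) \<le> norm (T s x) + e * h"
    proof eventually_elim
      case (elim h)
      have "T h y = (y + h *\<^sub>R A y) + h *\<^sub>R ((1 / h) *\<^sub>R (T h y - y) - A y)"
        using elim(2) by (simp add: scaleR_diff_right)
      then have "norm (T h y) \<le> norm (y + h *\<^sub>R A y) + h * dist ((1 / h) *\<^sub>R (T h y - y)) (A y)"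
        using elim(2) norm_triangle_ineq[of "y + h *\<^sub>R A y" "h *\<^sub>R ((1 / h) *\<^sub>R (T h y - y) - A y)"]
        by (simp only: norm_scaleR dist_norm) simp
      also have "\<dots> \<le> (norm y + e / 2 * h) + h * (e / 2)"
        using k[of h] elim by (intro add_mono mult_left_mono) (auto simp: pos_divide_less_eq)
      finally show ?case
        using C0_semigroup_add[OF assms(1), of h s x] elim(2) \<open>s \<ge> 0\<close>
        by (simp add: y_def algebra_simps)
    qed
  qed
  then show ?thesis by (simp add: C0_semigroup_zero[OF assms(1)])
qed

lemma exponential_bound_of_norm_deriv:
  fixes T :: "real \<Rightarrow> 'a::complex_banach \<Rightarrow> 'a"
  assumes "C0_semigroup T" "generates D A T" "densely_defined D"
    and quasi_diss: "\<And>x. x \<in> D \<Longrightarrow> norm_deriv x (A x) \<le> w * norm x"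
    and "t \<ge> 0"
  shows "norm (T t x) \<le> exp (t * w) * norm x"
proof -
  let ?S = "\<lambda>t x. exp (- of_real w * of_real t) *\<^sub>C T t x"
  note S = C0_semigroup_rescale[OF assms(1), of "of_real w"]
  note gen = generates_rescale[OF assms(2), of "of_real w"]
  have "norm_deriv x (A x - of_real w *\<^sub>C x) \<le> 0" if "x \<in> D" for x
    using norm_deriv_add_le[of x "A x" "(- w) *\<^sub>R x"] norm_deriv_same_le[of x "- w"] quasi_diss[OF that]
    by (simp flip: scaleR_scaleC)
  then have D: "norm (?S t x) \<le> norm x" if "x \<in> D" for x
    by (rule dissipative_generator_contraction[OF S gen _ that assms(5)])
  interpret St: bounded_linear "?S t" by (rule C0_semigroup_bounded_linear[OF S assms(5)])
  have "closed {x. norm (?S t x) \<le> norm x}"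
    by (intro closed_Collect_le continuous_on_norm St.continuous_on continuous_on_id)
  moreover have "D \<subseteq> {x. norm (?S t x) \<le> norm x}" using D by blast
  ultimately have "closure D \<subseteq> {x. norm (?S t x) \<le> norm x}" by (rule closure_minimal[rotated])
  then have "norm (?S t x) \<le> norm x" using assms(3) unfolding densely_defined_def by blast
  moreover have "norm (?S t x) = exp (- (t * w)) * norm (T t x)"
    by (simp add: norm_scaleC norm_exp_eq_Re mult.commute)
  ultimately have "exp (- (t * w)) * norm (T t x) \<le> norm x" by (simp only:)
  then show ?thesis by (simp add: exp_minus field_simps)
qed

section \<open>Growth bounds\<close>

text \<open>
  The value \<open>r = 0\<close> is included: there the logarithm is \<open>-\<infinity>\<close>, as it happens for nilpotent semigroups
  and on the zero space.
\<close>

lemma mult_elog_le_iff: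
  assumes "t > 0" "r \<ge> 0"
  shows "ereal (1 / t) * elog r \<le> ereal c \<longleftrightarrow> r \<le> exp (t * c)"
proof (cases "r = 0")
  case True
  then show ?thesis using assms(1) by (simp add: elog_def)
next
  case False
  with assms have "r > 0" by simp
  then have "r \<le> exp (t * c) \<longleftrightarrow> ln r \<le> t * c"
    by (metis exp_le_cancel_iff exp_ln)
  then show ?thesis
    using assms False by (simp add: elog_def field_simps)
qed

lemma onorm_C0_semigroup_nonneg: "C0_semigroup T \<Longrightarrow> t \<ge> 0 \<Longrightarrow> onorm (T t) \<ge> 0"
  by (intro onorm_pos_le C0_semigroup_bounded_linear)

lemma onorm_C0_semigroup_multiple_le:
  fixes T :: "real \<Rightarrow> 'a::complex_banach \<Rightarrow> 'a"
  assumes "C0_semigroup T" "t \<ge> 0" "onorm (T t) \<le> exp (t * c)"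
  shows "onorm (T (real n * t)) \<le> exp (real n * t * c)"
proof (induction n)
  case 0
  show ?case
    by (rule onorm_bound) (simp_all add: C0_semigroup_zero[OF assms(1)])
next
  case (Suc n)
  have "T (real (Suc n) * t) = T t \<circ> T (real n * t)"
    using C0_semigroup_add[OF assms(1,2), of "real n * t"] assms(2)
    by (simp add: fun_eq_iff distrib_right)
  then have "onorm (T (real (Suc n) * t)) \<le> onorm (T t) * onorm (T (real n * t))"
    using onorm_compose[of "T t" "T (real n * t)"] assms(2)
    by (simp add: C0_semigroup_bounded_linear[OF assms(1)])
  also have "\<dots> \<le> exp (t * c) * exp (real n * t * c)"
    by (intro mult_mono assms(3) Suc.IH) (use assms in \<open>auto intro: onorm_C0_semigroup_nonneg\<close>)
  also have "\<dots> = exp (real (Suc n) * t * c)"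
    by (simp add: algebra_simps flip: exp_add)
  finally show ?case .
qed

text \<open>
  A vector that witnesses the lower bound at time \<open>s\<close> witnesses it, by continuity of its orbit, at all
  times near \<open>s\<close>. Among these is a multiple \<open>n t\<close> of every small \<open>t\<close>, and an upper bound at time
  \<open>t\<close> would be inherited by \<open>n t\<close>.
\<close>

lemma onorm_greater_persists:
  fixes T :: "real \<Rightarrow> 'a::complex_banach \<Rightarrow> 'a"
  assumes "C0_semigroup T" "s > 0" "onorm (T s) > exp (s * c)"
  shows "\<forall>\<^sub>F t in at_right 0. onorm (T t) > exp (t * c)"
proof -
  obtain x where x: "norm (T s x) > exp (s * c) * norm x"
    using assms(3) onorm_bound[of "exp (s * c)" "T s"] by (meson exp_ge_zero not_le)
  have "continuous_on {0..} (\<lambda>u. norm (T u x) - exp (u * c) * norm x)"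
    by (intro continuous_intros C0_semigroup_continuous_on[OF assms(1)])
  then have "continuous_on {0<..} (\<lambda>u. norm (T u x) - exp (u * c) * norm x)"
    by (rule continuous_on_subset) auto
  then have "((\<lambda>u. norm (T u x) - exp (u * c) * norm x) \<longlongrightarrow> norm (T s x) - exp (s * c) * norm x) (at s)"
    using assms(2) by (simp add: continuous_on_eq_continuous_at isCont_def)
  from order_tendstoD(1)[OF this, of 0] x
  obtain d where "d > 0" and d: "\<And>u. u \<noteq> s \<Longrightarrow> dist u s < d \<Longrightarrow> norm (T u x) > exp (u * c) * norm x"
    by (auto simp: eventually_at)
  have near: "onorm (T u) > exp (u * c)" if "u \<ge> 0" "dist u s < d" for u
  proof -
    have "exp (u * c) * norm x < norm (T u x)" using d[of u] x that by (cases "u = s") auto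
    also have "\<dots> \<le> onorm (T u) * norm x"
      by (rule onorm[OF C0_semigroup_bounded_linear[OF assms(1) that(1)]])
    finally show ?thesis by (simp add: mult_less_cancel_right)
  qed
  show ?thesis
  proof (rule eventually_at_rightI[OF _ \<open>d > 0\<close>])
    fix t assume t: "t \<in> {0<..<d}"
    \<comment> \<open>The largest multiple of \<open>t\<close> up to \<open>s\<close> is within \<open>t < d\<close> of \<open>s\<close>.\<close>
    define n where "n = nat \<lfloor>s / t\<rfloor>"
    have "real n \<le> s / t" "s / t < real n + 1"
      using t assms(2) by (auto simp: n_def floor_less_cancel)
    then have "real n * t \<le> s" "s < real n * t + t"
      using t by (auto simp: field_simps)
    then have "onorm (T (real n * t)) > exp (real n * t * c)"
      using t by (intro near) (auto simp: dist_real_def)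
    then show "onorm (T t) > exp (t * c)"
      using onorm_C0_semigroup_multiple_le[OF assms(1), of t c n] t by force
  qed
qed

lemma tendsto_log_onorm_SUP:
  fixes T :: "real \<Rightarrow> 'a::complex_banach \<Rightarrow> 'a"
  assumes "C0_semigroup T"
  shows "((\<lambda>t. ereal (1 / t) * elog (onorm (T t)))
         \<longlongrightarrow> (SUP t\<in>{0<..}. ereal (1 / t) * elog (onorm (T t)))) (at_right 0)"
    (is "(?f \<longlongrightarrow> ?s) _")
proof (rule order_tendstoI)
  have f_less: "ereal c < ?f t \<longleftrightarrow> exp (t * c) < onorm (T t)" if "t > 0" for t c
    using mult_elog_le_iff[OF that onorm_C0_semigroup_nonneg[OF assms], of t c] that
    by (simp flip: not_le)
  fix a assume "a < ?s"
  then obtain s where s: "s > 0" "a < ?f s" by (auto simp: less_SUP_iff)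
  then obtain c where c: "a < ereal c" "ereal c < ?f s" using ereal_dense2 by blast
  have "\<forall>\<^sub>F t in at_right 0. onorm (T t) > exp (t * c)"
    using onorm_greater_persists[OF assms s(1)] c(2) f_less[OF s(1)] by simp
  moreover have "\<forall>\<^sub>F t in at_right (0::real). t > 0"
    by (rule eventually_at_right_less)
  ultimately show "\<forall>\<^sub>F t in at_right 0. a < ?f t"
  proof eventually_elim
    case (elim t)
    then show ?case using f_less[of t c] c(1) less_trans by blast
  qed
next
  fix a assume "?s < a"
  show "\<forall>\<^sub>F t in at_right 0. ?f t < a"
    by (rule eventually_mono[OF eventually_at_right_less])
       (rule le_less_trans[OF SUP_upper \<open>?s < a\<close>], simp)
qed

lemma INF_real_upper_bounds: "(INF w\<in>{w. s \<le> ereal w}. ereal w) = s"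
proof (rule antisym)
  show "(INF w\<in>{w. s \<le> ereal w}. ereal w) \<le> s"
  proof (rule ccontr)
    assume "\<not> ?thesis"
    then obtain w where "s < ereal w" "ereal w < (INF w\<in>{w. s \<le> ereal w}. ereal w)"
      using ereal_dense2 by (metis not_le)
    moreover have "(INF w\<in>{w. s \<le> ereal w}. ereal w) \<le> ereal w"
      using \<open>s < ereal w\<close> by (intro INF_lower) simp
    ultimately show False by simp
  qed
qed (auto intro: INF_greatest)

text \<open>
  At \<open>t = 0\<close> the defining inequality of the growth bound holds trivially, so only positive times count.
\<close>

lemma numerical_growth_bound_eq_SUP:
  fixes T :: "real \<Rightarrow> 'a::complex_banach \<Rightarrow> 'a"
  assumes "C0_semigroup T"
  shows "numerical_growth_bound T = (SUP t\<in>{0<..}. ereal (1 / t) * elog (onorm (T t)))"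
    (is "_ = ?s")
proof -
  have T0: "onorm (T 0) \<le> 1"
    by (rule onorm_bound) (simp_all add: C0_semigroup_zero[OF assms])
  have "(\<forall>t\<ge>0. onorm (T t) \<le> exp (t * w)) \<longleftrightarrow> ?s \<le> ereal w" for w
  proof -
    have "(\<forall>t\<ge>0. onorm (T t) \<le> exp (t * w)) \<longleftrightarrow> (\<forall>t>0. onorm (T t) \<le> exp (t * w))"
      using T0 by (metis exp_zero less_eq_real_def mult_zero_left)
    also have "\<dots> \<longleftrightarrow> ?s \<le> ereal w"
      by (auto simp: SUP_le_iff mult_elog_le_iff onorm_C0_semigroup_nonneg[OF assms])
    finally show ?thesis .
  qed
  then show ?thesis
    unfolding numerical_growth_bound_def by (simp only: INF_real_upper_bounds)
qed

lemma numerical_spectral_bound_le: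
  fixes T :: "real \<Rightarrow> 'a::complex_banach \<Rightarrow> 'a"
  assumes "linear_operator D A" "C0_semigroup T" "generates D A T"
    and bound: "\<And>t. t \<ge> 0 \<Longrightarrow> onorm (T t) \<le> exp (t * w)"
  shows "numerical_spectral_bound D A \<le> ereal w"
proof -
  have norm: "norm (T t x) \<le> exp (t * w) * norm x" if "t \<ge> 0" for t x
    using onorm[OF C0_semigroup_bounded_linear[OF assms(2) that], of x] bound[OF that]
    by (meson mult_right_mono norm_ge_zero order_trans)
  note R = resolvent_of_exponential_bound[OF assms(1-3) norm]
  have Re: "Re z > w" if "z \<in> half_plane 0 w" for z
    using that by (simp add: mem_half_plane_iff)
  have "half_plane 0 w \<subseteq> resolvent_set D A"
    using R(1) Re by blast
  moreover have "\<forall>z\<in>half_plane 0 w. onorm (resolvent D A z) \<le> 1 / infdist z (frontier (half_plane 0 w))"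
    using R(2) Re by (simp add: infdist_frontier_half_plane)
  ultimately have "half_plane 0 w \<subseteq> numerical_resolvent_set D A"
    unfolding numerical_resolvent_set_def using pi_gt_zero by (intro Union_upper CollectI exI[of _ 0] exI[of _ w]) auto
  then have "Re z \<le> w" if "z \<in> numerical_spectrum D A" for z
    using that by (auto simp: numerical_spectrum_def mem_half_plane_iff subset_iff not_less[symmetric])
  then show ?thesis
    unfolding numerical_spectral_bound_def by (intro SUP_least) simp
qed

lemma onorm_le_of_numerical_spectral_bound:
  fixes T :: "real \<Rightarrow> 'a::complex_banach \<Rightarrow> 'a"
  assumes "linear_operator D A" "densely_defined D" "C0_semigroup T" "generates D A T"
    and "numerical_spectral_bound D A \<le> ereal w" "t \<ge> 0"
  shows "onorm (T t) \<le> exp (t * w)"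
proof (rule onorm_bound)
  have Re: "Re u \<le> w" if "u \<in> numerical_spectrum D A" for u
    using assms(5) that unfolding numerical_spectral_bound_def SUP_le_iff by auto
  have "norm_deriv x (A x) \<le> w * norm x" if "x \<in> D" for x
  proof (cases "x = 0")
    case True
    have "A (0 *\<^sub>C 0) = 0 *\<^sub>C A 0" using assms(1) unfolding linear_operator_def by blast
    with True show ?thesis by (simp add: scaleC.zero_left)
  next
    case False
    then show ?thesis
      using norm_deriv_eq_numerical_spectrum[OF assms(1,2) that] Re
      by (metis mult_right_mono norm_ge_zero)
  qed
  then show "norm (T t x) \<le> exp (t * w) * norm x" for x
    using exponential_bound_of_norm_deriv[OF assms(3,4,2) _ assms(6)] by blast
qed simp

theorem proposition3p4:
  fixes A :: "'a::complex_banach \<Rightarrow> 'a" and D :: "'a set" and T :: "real \<Rightarrow> 'a \<Rightarrow> 'a"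
  assumes "closed_operator D A" and "densely_defined D"
    and "C0_semigroup T" and "generates D A T"
  shows "numerical_spectral_bound D A = numerical_growth_bound T
    \<and> numerical_growth_bound T = (SUP t\<in>{0<..}. ereal (1 / t) * elog (onorm (T t)))
    \<and> ((\<lambda>t. ereal (1 / t) * elog (onorm (T t)))
         \<longlongrightarrow> (SUP t\<in>{0<..}. ereal (1 / t) * elog (onorm (T t)))) (at_right 0)"
proof (intro conjI)
  have lin: "linear_operator D A" using assms(1) by (simp add: closed_operator_def)
  have "(\<forall>t\<ge>0. onorm (T t) \<le> exp (t * w)) \<longleftrightarrow> numerical_spectral_bound D A \<le> ereal w" for w
    using numerical_spectral_bound_le[OF lin assms(3,4)]
      onorm_le_of_numerical_spectral_bound[OF lin assms(2-4)] by blast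
  then show "numerical_spectral_bound D A = numerical_growth_bound T"
    unfolding numerical_growth_bound_def by (simp only: INF_real_upper_bounds)
qed (rule numerical_growth_bound_eq_SUP[OF assms(3)] tendsto_log_onorm_SUP[OF assms(3)])+

end
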